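(* Let $k$ be a positive real number. The binomial transform $(b_{k,n})_{n\ge 0}$ of the modified $k$-Fibonacci-like sequence satisfies the recurrence relation $$b_{k,n+1} = (k+2)\,b_{k,n} - k\, b_{k,n-1}\quad\text{for all integers } n\ge 1,$$ with the initial conditions $b_{k,0}=2$ and $b_{k,1}=4$.
   Context: For a positive real number $k$, the modified $k$-Fibonacci-like sequence $(M_{k,n})_{n\ge 0}$ is defined by $M_{k,0}=M_{k,1}=2$ and $M_{k,n+1}=kM_{k,n}+M_{k,n-1}$ for $n\ge 1$. Its binomial transform $(b_{k,n})_{n\ge 0}$ is defined by $b_{k,n}=\sum_{i=0}^{n}\binom{n}{i}M_{k,i}$. *)

theory Defs
  imports Complex_Main
begin

fun mod_k_fib_like :: "real \<Rightarrow> nat \<Rightarrow> real" where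
  "mod_k_fib_like k 0 = 2"
| "mod_k_fib_like k (Suc 0) = 2"
| "mod_k_fib_like k (Suc (Suc n)) = k * mod_k_fib_like k (Suc n) + mod_k_fib_like k n"

definition binomial_transform :: "(nat \<Rightarrow> real) \<Rightarrow> nat \<Rightarrow> real" where
  "binomial_transform a n = (\<Sum>i=0..n. real (n choose i) * a i)"

end

theory Submission
  imports Defs
begin

text \<open>The binomial transform \<open>B\<close> turns the shift operator \<open>E\<close> into the forward difference
  \<open>\<Delta>\<close>: by Pascal's rule, \<open>B (E a) = \<Delta> (B a)\<close>
  (\<open>binomial_transform_shift\<close>). Since \<open>B\<close> is linear, a recurrence
  \<open>E\<^sup>2 a = p E a + q a\<close> becomes \<open>\<Delta>\<^sup>2 b = p \<Delta> b + q b\<close> for \<open>b = B a\<close>. Expanding the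
  differences gives \<open>b (n + 2) = (p + 2) b (n + 1) - (p + 1 - q) b n\<close>, and the
  \<open>k\<close>-Fibonacci-like sequence is the case \<open>p = k\<close>, \<open>q = 1\<close>.\<close>

lemma binomial_transform_shift:
  "binomial_transform (\<lambda>i. a (Suc i)) n = binomial_transform a (Suc n) - binomial_transform a n"
proof -
  have "binomial_transform a (Suc n)
      = a 0 + (\<Sum>i=0..n. real (Suc n choose Suc i) * a (Suc i))"
    unfolding binomial_transform_def by (subst sum.atLeast0_atMost_Suc_shift) simp
  also have "\<dots> = binomial_transform (\<lambda>i. a (Suc i)) n
      + (a 0 + (\<Sum>i=0..n. real (n choose Suc i) * a (Suc i)))"
    unfolding binomial_transform_def by (simp add: sum.distrib distrib_right)
  also have "a 0 + (\<Sum>i=0..n. real (n choose Suc i) * a (Suc i))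
      = (\<Sum>i=0..Suc n. real (n choose i) * a i)"
    by (subst sum.atLeast0_atMost_Suc_shift) simp
  \<comment> \<open>The top term has coefficient \<open>n choose (n + 1) = 0\<close>.\<close>
  also have "\<dots> = binomial_transform a n"
    unfolding binomial_transform_def by simp
  finally show ?thesis by simp
qed

lemma binomial_transform_linear:
  "binomial_transform (\<lambda>i. p * f i + q * g i) n
    = p * binomial_transform f n + q * binomial_transform g n"
  unfolding binomial_transform_def
  by (simp add: sum_distrib_left sum.distrib algebra_simps)

lemma binomial_transform_recurrence:
  assumes "\<And>i. a (Suc (Suc i)) = p * a (Suc i) + q * a i"
  shows "binomial_transform a (Suc (Suc n))
    = (p + 2) * binomial_transform a (Suc n) - (p + 1 - q) * binomial_transform a n"
proof -
  let ?b = "binomial_transform a"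
  have "?b (Suc (Suc n)) - ?b (Suc n) - (?b (Suc n) - ?b n)
      = binomial_transform (\<lambda>i. a (Suc (Suc i))) n"
    using binomial_transform_shift[of "\<lambda>i. a (Suc i)" n]
    by (simp add: binomial_transform_shift[of a])
  also have "\<dots> = p * (?b (Suc n) - ?b n) + q * ?b n"
    by (simp add: assms binomial_transform_linear binomial_transform_shift[of a])
  finally show ?thesis by (simp add: algebra_simps)
qed

theorem theorem4:
  fixes k :: real and b :: "nat \<Rightarrow> real"
  assumes "k > 0"
  defines "b \<equiv> binomial_transform (mod_k_fib_like k)"
  shows "(\<forall>n::nat. n \<ge> 1 \<longrightarrow> b (n + 1) = (k + 2) * b n - k * b (n - 1)) \<and> b 0 = 2 \<and> b 1 = 4"
proof (intro conjI allI impI)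
  fix n :: nat
  assume "n \<ge> 1"
  then obtain m where "n = Suc m" by (cases n) auto
  then show "b (n + 1) = (k + 2) * b n - k * b (n - 1)"
    using binomial_transform_recurrence[of "mod_k_fib_like k" k 1 m] by (simp add: b_def)
next
  show "b 0 = 2" "b 1 = 4"
    by (simp_all add: b_def binomial_transform_def)
qed

end
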